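(* Let $m,n\ge1$. The map $\phi:\mathsf{EW}_{m,n}\to\mathsf{LRib}_{m,n}$ described in the context is surjective: for every $(R,\ell)\in\mathsf{LRib}_{m,n}$ there exists $T\in\mathsf{EW}_{m,n}$ with $\phi(T)=(R,\ell)$.
   Context: All tableaux are $0/1$ arrays; $T_{ij}$ denotes the entry in row $i$ (rows numbered top to bottom) and column $j$ (columns numbered left to right). Labels are symbols $v_0,v_1,\dots,v_{m+n-1}$, ordered by $v_i<v_j$ iff $i<j$. Rectangular EW-tableau: an $m\times n$ $0/1$ tableau $T$ such that (i) every entry of the top row is $1$; (ii) every other row contains at least one $0$; (iii) there are no rows $i\ne i'$ and columns $k\ne k'$ with $T_{ik}=T_{i'k'}=0$ and $T_{ik'}=T_{i'k}=1$. $\mathsf{EW}_{m,n}$ is the set of these. The rows of $T$ are labelled $v_0,\dots,v_{m-1}$ from top to bottom and the columns $v_m,\dots,v_{m+n-1}$ from left to right. Parallelogram polyomino of type $(m,n)$: an $m\times n$ $0/1$ tableau $P$ with $P_{11}=P_{mn}=1$, such that every row contains at least one $1$ and the $1$s in each row are contiguous, and for each $2\le i\le m$: the leftmost $1$ of row $i$ is weakly to the right of the leftmost $1$ of row $i-1$ and weakly to the left of the rightmost $1$ of row $i-1$, and the rightmost $1$ of row $i$ is weakly to the right of the rightmost $1$ of row $i-1$. It is a ribbon parallelogram polyomino if it has exactly $m+n-1$ entries equal to $1$. Labelled parallelogram polyomino of type $(m,n)$: a pair $(P,\ell)$ with $P$ a parallelogram polyomino of type $(m,n)$ and $\ell=(\ell(\mathrm{row}_1),\dots,\ell(\mathrm{row}_m),\ell(\mathrm{col}_1),\dots,\ell(\mathrm{col}_n))$,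 where the row labels are a permutation of $\{v_0,\dots,v_{m-1}\}$ with $\ell(\mathrm{row}_1)=v_0$ and such that the labels of rows whose leftmost $1$s lie in the same column are increasing from top to bottom, and the column labels are a permutation of $\{v_m,\dots,v_{m+n-1}\}$ such that the labels of columns whose topmost $1$s lie in the same row are increasing from left to right. $\mathsf{LRib}_{m,n}$ is the set of those with $P$ a ribbon parallelogram polyomino. The map $\phi$: given $T\in\mathsf{EW}_{m,n}$ with its labels, (1) permute the columns (carrying their labels) so that every entry to the left of a $0$ is a $0$, with identical columns placed so their labels increase from left to right; (2) then permute the rows (carrying labels) so that every entry above a $1$ is a $1$, with identical rows placed so their labels increase from top to bottom; call the result $T'$ and the resulting labelling $\ell$. (3) Let $R$ be the $m\times n$ tableau with $R_{ij}=1$ if either [$T'_{ij}=1$ and ($i=m$ or $T'_{i+1,j}=0$)] or [$T'_{ij}=0$ and ($j=n$ or $T'_{i,j+1}=1$)], and $R_{ij}=0$ otherwise. Set $\phi(T)=(R,\ell)$; this lies in $\mathsf{LRib}_{m,n}$. *)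

theory Defs
  imports
    "Jordan_Normal_Form.Matrix"
    "HOL-Library.Z2"
    "HOL-Combinatorics.Permutations"
    "HOL-Combinatorics.Multiset_Permutations"
begin

text \<open>
  A 0/1 tableau is a matrix over the two-element type \<^typ>\<open>bit\<close>, whose field structure plays no role.
  Rows and columns are indexed from 0, and the label \<open>v\<^sub>k\<close> is the natural number \<open>k\<close>.
  A labelled tableau is a triple \<open>(T, r, c)\<close>, where \<open>r ! i\<close> is the label of row \<open>i\<close> and
  \<open>c ! j\<close> is the label of column \<open>j\<close>.
\<close>

type_synonym tableau = "bit mat"
type_synonym labelled_tableau = "tableau \<times> nat list \<times> nat list"


subsection \<open>Rectangular EW-tableaux\<close>

definition EW :: "nat \<Rightarrow> nat \<Rightarrow> tableau set" where
  "EW m n = {T \<in> carrier_mat m n.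
     (\<forall>j<n. T $$ (0, j) = 1) \<and>
     (\<forall>i<m. i \<noteq> 0 \<longrightarrow> (\<exists>j<n. T $$ (i, j) = 0)) \<and>
     \<not> (\<exists>i<m. \<exists>i'<m. \<exists>k<n. \<exists>k'<n. i \<noteq> i' \<and> k \<noteq> k' \<and>
          T $$ (i, k) = 0 \<and> T $$ (i', k') = 0 \<and> T $$ (i, k') = 1 \<and> T $$ (i', k) = 1)}"

definition EW_labelling :: "tableau \<Rightarrow> labelled_tableau" where
  "EW_labelling T = (T, [0..<dim_row T], [dim_row T..<dim_row T + dim_col T])"


subsection \<open>Labelled parallelogram polyominoes\<close>

definition leftmost :: "tableau \<Rightarrow> nat \<Rightarrow> nat" where
  "leftmost P i = Min {j. j < dim_col P \<and> P $$ (i, j) = 1}"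

definition rightmost :: "tableau \<Rightarrow> nat \<Rightarrow> nat" where
  "rightmost P i = Max {j. j < dim_col P \<and> P $$ (i, j) = 1}"

definition topmost :: "tableau \<Rightarrow> nat \<Rightarrow> nat" where
  "topmost P j = Min {i. i < dim_row P \<and> P $$ (i, j) = 1}"

definition parallelogram_polyominoes :: "nat \<Rightarrow> nat \<Rightarrow> tableau set" where
  "parallelogram_polyominoes m n = {P \<in> carrier_mat m n.
     P $$ (0, 0) = 1 \<and> P $$ (m - 1, n - 1) = 1 \<and>
     (\<forall>i<m. \<exists>j<n. P $$ (i, j) = 1) \<and>
     (\<forall>i<m. \<forall>j k l. j < k \<and> k < l \<and> l < n \<and> P $$ (i, j) = 1 \<and> P $$ (i, l) = 1
        \<longrightarrow> P $$ (i, k) = 1) \<and>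
     (\<forall>i<m. 1 \<le> i \<longrightarrow>
        leftmost P (i - 1) \<le> leftmost P i \<and>
        leftmost P i \<le> rightmost P (i - 1) \<and>
        rightmost P (i - 1) \<le> rightmost P i)}"

definition ribbon_polyominoes :: "nat \<Rightarrow> nat \<Rightarrow> tableau set" where
  "ribbon_polyominoes m n = {P \<in> parallelogram_polyominoes m n.
     card {(i, j). i < m \<and> j < n \<and> P $$ (i, j) = 1} = m + n - 1}"

definition labelled_polyominoes :: "nat \<Rightarrow> nat \<Rightarrow> labelled_tableau set" where
  "labelled_polyominoes m n = {(P, r, c).
     P \<in> parallelogram_polyominoes m n \<and>
     r \<in> permutations_of_set {0..<m} \<and>
     r ! 0 = 0 \<and>
     (\<forall>i i'. i < i' \<and> i' < m \<and> leftmost P i = leftmost P i' \<longrightarrow> r ! i < r ! i') \<and>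
     c \<in> permutations_of_set {m..<m + n} \<and>
     (\<forall>j j'. j < j' \<and> j' < n \<and> topmost P j = topmost P j' \<longrightarrow> c ! j < c ! j')}"

definition LRib :: "nat \<Rightarrow> nat \<Rightarrow> labelled_tableau set" where
  "LRib m n = {(P, r, c) \<in> labelled_polyominoes m n. P \<in> ribbon_polyominoes m n}"


subsection \<open>The map from EW-tableaux to labelled ribbon polyominoes\<close>

fun permute_cols :: "(nat \<Rightarrow> nat) \<Rightarrow> labelled_tableau \<Rightarrow> labelled_tableau" where
  "permute_cols p (T, r, c) =
     (mat (dim_row T) (dim_col T) (\<lambda>(i, j). T $$ (i, p j)), r, permute_list p c)"

fun permute_rows :: "(nat \<Rightarrow> nat) \<Rightarrow> labelled_tableau \<Rightarrow> labelled_tableau" where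
  "permute_rows p (T, r, c) =
     (mat (dim_row T) (dim_col T) (\<lambda>(i, j). T $$ (p i, j)), permute_list p r, c)"

fun cols_arranged :: "labelled_tableau \<Rightarrow> bool" where
  "cols_arranged (T, r, c) \<longleftrightarrow>
     (\<forall>i<dim_row T. \<forall>j j'. j < j' \<and> j' < dim_col T \<and> T $$ (i, j') = 0 \<longrightarrow> T $$ (i, j) = 0) \<and>
     (\<forall>j j'. j < j' \<and> j' < dim_col T \<and> col T j = col T j' \<longrightarrow> c ! j < c ! j')"

fun rows_arranged :: "labelled_tableau \<Rightarrow> bool" where
  "rows_arranged (T, r, c) \<longleftrightarrow>
     (\<forall>j<dim_col T. \<forall>i i'. i < i' \<and> i' < dim_row T \<and> T $$ (i', j) = 1 \<longrightarrow> T $$ (i, j) = 1) \<and>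
     (\<forall>i i'. i < i' \<and> i' < dim_row T \<and> row T i = row T i' \<longrightarrow> r ! i < r ! i')"

text \<open>
  For tableaux in \<^const>\<open>EW\<close> the arrangements below exist and are unique: by the forbidden pattern
  condition, the zero sets of any two columns (and of any two rows) are comparable, and distinct
  labels order identical columns (rows).
\<close>

definition arrange_cols :: "labelled_tableau \<Rightarrow> labelled_tableau" where
  "arrange_cols X =
     (THE Y. (\<exists>p. p permutes {..<dim_col (fst X)} \<and> Y = permute_cols p X) \<and> cols_arranged Y)"

definition arrange_rows :: "labelled_tableau \<Rightarrow> labelled_tableau" where
  "arrange_rows X =
     (THE Y. (\<exists>p. p permutes {..<dim_row (fst X)} \<and> Y = permute_rows p X) \<and> rows_arranged Y)"

definition border_ribbon :: "tableau \<Rightarrow> tableau" where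
  "border_ribbon T = mat (dim_row T) (dim_col T) (\<lambda>(i, j).
     if T $$ (i, j) = 1 \<and> (i = dim_row T - 1 \<or> T $$ (i + 1, j) = 0) \<or>
        T $$ (i, j) = 0 \<and> (j = dim_col T - 1 \<or> T $$ (i, j + 1) = 1)
     then 1 else 0)"

definition phi :: "tableau \<Rightarrow> labelled_tableau" where
  "phi T = (let (T', r, c) = arrange_rows (arrange_cols (EW_labelling T))
            in (border_ribbon T', r, c))"

end

theory Submission imports Defs begin

text \<open>
  Let \<open>a\<^sub>i\<close> be the column of the leftmost 1 in row \<open>i\<close> of a ribbon, and \<open>a\<^sub>m = n - 1\<close>.
  Counting cells forces the rightmost 1 of row \<open>i\<close> to lie in column \<open>a\<^sub>i\<^sub>+\<^sub>1\<close>, so row \<open>i\<close>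
  occupies exactly the columns from \<open>a\<^sub>i\<close> to \<open>a\<^sub>i\<^sub>+\<^sub>1\<close> and the ribbon is determined by the
  \<open>a\<^sub>i\<close>. It is the border ribbon of the staircase tableau whose row \<open>i > 0\<close> has its zeros in the
  columns \<open>0, \<dots>, a\<^sub>i\<close>, and the label conditions on the ribbon say that the labelled staircase is
  arranged. Moving each row and column of the staircase to the position named by its label gives
  the preimage, because an arrangement of rows or columns is unique.
\<close>

unbundle no m_inv_syntax

section \<open>Uniqueness of arrangements\<close>

lemma strict_mono_permutes_eq_id:
  fixes p :: "nat \<Rightarrow> nat"
  assumes p: "p permutes {..<n}"
    and mono: "\<And>i j. i < j \<Longrightarrow> j < n \<Longrightarrow> p i < p j"
  shows "p = id"
proof -
  have "map p [0..<n] = [0..<n]"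
  proof (rule sorted_distinct_set_unique)
    show "sorted (map p [0..<n])"
      by (auto simp: sorted_iff_nth_mono_less intro: less_imp_le mono)
    show "distinct (map p [0..<n])"
      using permutes_inj_on[OF p] by (simp add: distinct_map)
    show "set (map p [0..<n]) = set [0..<n]"
      using permutes_image[OF p] by (simp add: atLeast0LessThan)
  qed auto
  then have "p i = i" if "i < n" for i
    using that by (metis add_0 diff_zero length_upt nth_map nth_upt)
  then show ?thesis
    using permutes_not_in[OF p] by (metis eq_id_iff lessThan_iff)
qed

text \<open>The permutation \<open>inv p \<circ> q\<close> is strictly increasing, hence the
  identity. If it put \<open>i\<close> above \<open>j\<close> for some \<open>i < j\<close>,
  sortedness of \<open>p\<close> would give \<open>lt (q j) (q i)\<close>, against
  \<open>lt (q i) (q j)\<close> and asymmetry.\<close>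

lemma sorting_permutes_unique:
  fixes p q :: "nat \<Rightarrow> nat"
  assumes p: "p permutes {..<n}" and q: "q permutes {..<n}"
    and asym: "\<And>x y. x < n \<Longrightarrow> y < n \<Longrightarrow> lt x y \<Longrightarrow> \<not> lt y x"
    and sorted_p: "\<And>i j. i < j \<Longrightarrow> j < n \<Longrightarrow> lt (p i) (p j)"
    and sorted_q: "\<And>i j. i < j \<Longrightarrow> j < n \<Longrightarrow> lt (q i) (q j)"
  shows "p = q"
proof -
  let ?s = "inv p \<circ> q"
  have s: "?s permutes {..<n}"
    by (intro permutes_compose q permutes_inv p)
  have id: "?s = id"
  proof (rule strict_mono_permutes_eq_id[OF s])
    fix i j assume ij: "i < j" "j < n"
    have ps: "p (?s k) = q k" for k
      using permutes_inverses(1)[OF p] by simp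
    have bounds: "?s i < n" "q i < n" "q j < n"
      using permutes_in_image[OF s] permutes_in_image[OF q] ij by auto
    have "\<not> lt (q j) (q i)"
      using asym sorted_q ij bounds by blast
    moreover have "?s i \<noteq> ?s j"
      using permutes_inj[OF s] ij by (metis inj_eq less_irrefl)
    ultimately show "?s i < ?s j"
      using sorted_p[of "?s j" "?s i"] bounds unfolding ps by linarith
  qed
  have "q i = p i" for i
  proof -
    have "inv p (q i) = i"
      using fun_cong[OF id, of i] unfolding o_apply id_apply .
    then show ?thesis
      using permutes_inverses(1)[OF p, of "q i"] by simp
  qed
  then show ?thesis
    by auto
qed

text \<open>Any permutation that yields an arranged tableau identifies the value of the definite
  description. Existence is supplied by \<open>p\<close>; uniqueness holds because every arranging
  permutation sorts the original columns by one fixed asymmetric relation.\<close>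

lemma arrange_cols_permute_cols:
  assumes p: "p permutes {..<dim_col T}" and len: "length c = dim_col T"
    and arranged: "cols_arranged (permute_cols p (T, r, c))"
  shows "arrange_cols (T, r, c) = permute_cols p (T, r, c)"
proof -
  \<comment> \<open>The relation compares original columns and mentions no permutation, so it can be
    applied to two competing arrangements at once.\<close>
  define lt where "lt x y \<longleftrightarrow> (\<forall>i<dim_row T. T $$ (i, y) = 0 \<longrightarrow> T $$ (i, x) = 0) \<and>
      (col T x = col T y \<longrightarrow> c ! x < c ! y)" for x y
  have sorted: "lt (q j) (q j')"
    if q: "q permutes {..<dim_col T}" and arr: "cols_arranged (permute_cols q (T, r, c))"
      and j: "j < j'" "j' < dim_col T" for q j j'
  proof -
    let ?T = "mat (dim_row T) (dim_col T) (\<lambda>(i, j). T $$ (i, q j))"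
    have qk: "q k < dim_col T" if "k < dim_col T" for k
      using permutes_in_image[OF q, of k] that by simp
    have col: "col ?T k = col T (q k)" if "k < dim_col T" for k
      using that qk by (intro eq_vecI) auto
    have lab: "permute_list q c ! k = c ! q k" if "k < dim_col T" for k
      using that q len by (simp add: permute_list_nth)
    note arr' = arr[unfolded permute_cols.simps cols_arranged.simps dim_row_mat dim_col_mat]
    have "T $$ (i, q j) = 0" if "i < dim_row T" "T $$ (i, q j') = 0" for i
      using arr'[THEN conjunct1, rule_format, OF that(1), of j j'] that j by simp
    moreover have "c ! q j < c ! q j'" if "col T (q j) = col T (q j')"
    proof -
      have "col ?T j = col ?T j'"
        using that by (simp only: col[OF less_trans[OF j]] col[OF j(2)])
      from arr'[THEN conjunct2, rule_format, OF conjI[OF j(1) conjI[OF j(2) this]]]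
      show ?thesis
        unfolding lab[OF less_trans[OF j]] lab[OF j(2)] .
    qed
    ultimately show ?thesis
      unfolding lt_def by blast
  qed
  \<comment> \<open>Mutual inclusion of zero sets makes the two columns equal, and then the labels
    would have to increase in both directions.\<close>
  have asym: "\<not> lt y x" if "x < dim_col T" "y < dim_col T" "lt x y" for x y
  proof
    assume "lt y x"
    have "T $$ (i, x) = T $$ (i, y)" if "i < dim_row T" for i
    proof -
      have "T $$ (i, x) = 0 \<longleftrightarrow> T $$ (i, y) = 0"
        using \<open>lt x y\<close> \<open>lt y x\<close> that unfolding lt_def by blast
      then show ?thesis
        by (cases "T $$ (i, x)"; cases "T $$ (i, y)") simp_all
    qed
    then have "col T x = col T y"
      using that by (intro eq_vecI) auto
    then show False
      using \<open>lt x y\<close> \<open>lt y x\<close> unfolding lt_def by (metis less_asym)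
  qed
  show ?thesis
    unfolding arrange_cols_def
  proof (rule the_equality)
    fix Y
    assume "(\<exists>q. q permutes {..<dim_col (fst (T, r, c))} \<and> Y = permute_cols q (T, r, c))
      \<and> cols_arranged Y"
    then obtain q where q: "q permutes {..<dim_col T}" "Y = permute_cols q (T, r, c)"
      "cols_arranged (permute_cols q (T, r, c))" by auto
    have "q = p"
      using sorting_permutes_unique[where lt = lt, OF q(1) p asym sorted[OF q(1,3)] sorted[OF p arranged]] .
    then show "Y = permute_cols p (T, r, c)"
      using q by simp
  qed (use p arranged in auto)
qed

text \<open>The same argument for rows, with inclusion of sets of ones in place of inclusion of sets
  of zeros.\<close>

lemma arrange_rows_permute_rows:
  assumes p: "p permutes {..<dim_row T}" and len: "length r = dim_row T"
    and arranged: "rows_arranged (permute_rows p (T, r, c))"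
  shows "arrange_rows (T, r, c) = permute_rows p (T, r, c)"
proof -
  define lt where "lt x y \<longleftrightarrow> (\<forall>j<dim_col T. T $$ (y, j) = 1 \<longrightarrow> T $$ (x, j) = 1) \<and>
      (row T x = row T y \<longrightarrow> r ! x < r ! y)" for x y
  have sorted: "lt (q i) (q i')"
    if q: "q permutes {..<dim_row T}" and arr: "rows_arranged (permute_rows q (T, r, c))"
      and i: "i < i'" "i' < dim_row T" for q i i'
  proof -
    let ?T = "mat (dim_row T) (dim_col T) (\<lambda>(i, j). T $$ (q i, j))"
    have qk: "q k < dim_row T" if "k < dim_row T" for k
      using permutes_in_image[OF q, of k] that by simp
    have row: "row ?T k = row T (q k)" if "k < dim_row T" for k
      using that qk by (intro eq_vecI) auto
    have lab: "permute_list q r ! k = r ! q k" if "k < dim_row T" for k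
      using that q len by (simp add: permute_list_nth)
    note arr' = arr[unfolded permute_rows.simps rows_arranged.simps dim_row_mat dim_col_mat]
    have "T $$ (q i, j) = 1" if "j < dim_col T" "T $$ (q i', j) = 1" for j
      using arr'[THEN conjunct1, rule_format, OF that(1), of i i'] that i by simp
    moreover have "r ! q i < r ! q i'" if "row T (q i) = row T (q i')"
    proof -
      have "row ?T i = row ?T i'"
        using that by (simp only: row[OF less_trans[OF i]] row[OF i(2)])
      from arr'[THEN conjunct2, rule_format, OF conjI[OF i(1) conjI[OF i(2) this]]]
      show ?thesis
        unfolding lab[OF less_trans[OF i]] lab[OF i(2)] .
    qed
    ultimately show ?thesis
      unfolding lt_def by blast
  qed
  have asym: "\<not> lt y x" if "x < dim_row T" "y < dim_row T" "lt x y" for x y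
  proof
    assume "lt y x"
    have "T $$ (x, j) = T $$ (y, j)" if "j < dim_col T" for j
    proof -
      have "T $$ (x, j) = 1 \<longleftrightarrow> T $$ (y, j) = 1"
        using \<open>lt x y\<close> \<open>lt y x\<close> that unfolding lt_def by blast
      then show ?thesis
        by (cases "T $$ (x, j)"; cases "T $$ (y, j)") simp_all
    qed
    then have "row T x = row T y"
      using that by (intro eq_vecI) auto
    then show False
      using \<open>lt x y\<close> \<open>lt y x\<close> unfolding lt_def by (metis less_asym)
  qed
  show ?thesis
    unfolding arrange_rows_def
  proof (rule the_equality)
    fix Y
    assume "(\<exists>q. q permutes {..<dim_row (fst (T, r, c))} \<and> Y = permute_rows q (T, r, c))
      \<and> rows_arranged Y"
    then obtain q where q: "q permutes {..<dim_row T}" "Y = permute_rows q (T, r, c)"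
      "rows_arranged (permute_rows q (T, r, c))" by auto
    have "q = p"
      using sorting_permutes_unique[where lt = lt, OF q(1) p asym sorted[OF q(1,3)] sorted[OF p arranged]] .
    then show "Y = permute_rows p (T, r, c)"
      using q by simp
  qed (use p arranged in auto)
qed

section \<open>Undoing an arrangement\<close>

lemma permute_list_inv_cancel:
  assumes "p permutes {..<length xs}"
  shows "permute_list p (permute_list (inv p) xs) = xs"
  using assms permute_list_compose[OF assms, of "inv p"]
  by (simp add: permutes_inv_o)

lemma permute_cols_inv_cancel:
  assumes p: "p permutes {..<dim_col T}" and "length c = dim_col T"
  shows "permute_cols p (permute_cols (inv p) (T, r, c)) = (T, r, c)"
proof -
  have "p j < dim_col T" if "j < dim_col T" for j
    using permutes_in_image[OF p, of j] that by simp
  then have "mat (dim_row T) (dim_col T) (\<lambda>(i, j). mat (dim_row T) (dim_col T)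
      (\<lambda>(i, j). T $$ (i, inv p j)) $$ (i, p j)) = T"
    by (intro eq_matI) (simp_all add: permutes_inverses(2)[OF p])
  then show ?thesis
    using assms by (simp add: permute_list_inv_cancel)
qed

lemma permute_rows_inv_cancel:
  assumes p: "p permutes {..<dim_row T}" and "length r = dim_row T"
  shows "permute_rows p (permute_rows (inv p) (T, r, c)) = (T, r, c)"
proof -
  have "p i < dim_row T" if "i < dim_row T" for i
    using permutes_in_image[OF p, of i] that by simp
  then have "mat (dim_row T) (dim_col T) (\<lambda>(i, j). mat (dim_row T) (dim_col T)
      (\<lambda>(i, j). T $$ (inv p i, j)) $$ (p i, j)) = T"
    by (intro eq_matI) (simp_all add: permutes_inverses(2)[OF p])
  then show ?thesis
    using assms by (simp add: permute_list_inv_cancel)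
qed

text \<open>\<open>phi\<close> arranges columns while the rows are still in label order. This lemma
  carries the column arrangement of the final tableau back to that intermediate stage.\<close>

lemma cols_arranged_permute_rows:
  assumes p: "p permutes {..<dim_row T}" and arranged: "cols_arranged (T, r, c)"
  shows "cols_arranged (permute_rows p (T, r, c))"
proof -
  let ?T = "mat (dim_row T) (dim_col T) (\<lambda>(i, j). T $$ (p i, j))"
  have pi: "p i < dim_row T" if "i < dim_row T" for i
    using permutes_in_image[OF p, of i] that by simp
  \<comment> \<open>Equality of columns is reflected by a row permutation: entry \<open>i\<close> of
    the original column is entry \<open>inv p i\<close> of the permuted one.\<close>
  have col: "col T j = col T j'" if "col ?T j = col ?T j'" "j < dim_col T" "j' < dim_col T" for j j'
  proof (rule eq_vecI)
    fix i assume "i < dim_vec (col T j')"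
    then have i: "i < dim_row T" by simp
    then have "inv p i < dim_row T"
      using permutes_in_image[OF permutes_inv[OF p], of i] by simp
    then show "col T j $ i = col T j' $ i"
      using arg_cong[OF that(1), of "\<lambda>v. v $ inv p i"] that(2,3) i
      by (simp add: permutes_inverses(1)[OF p])
  qed simp
  note arr = arranged[unfolded cols_arranged.simps]
  show ?thesis
    unfolding permute_rows.simps cols_arranged.simps dim_row_mat dim_col_mat
  proof (intro conjI allI impI; elim conjE)
    fix i j j'
    assume i: "i < dim_row T" and j: "j < j'" "j' < dim_col T" and "?T $$ (i, j') = 0"
    then show "?T $$ (i, j) = 0"
      using arr[THEN conjunct1, rule_format, OF pi[OF i], of j j'] by simp
  next
    fix j j'
    assume j: "j < j'" "j' < dim_col T" and "col ?T j = col ?T j'"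
    then show "c ! j < c ! j'"
      using arr[THEN conjunct2, rule_format, of j j'] col[of j j'] by (meson less_trans)
  qed
qed

text \<open>The two arranging steps are undone in reverse order, rows first and then columns. The
  last conclusion lets entrywise properties of \<open>T'\<close> be transferred to
  \<open>T\<close>.\<close>

lemma arranged_preimage:
  assumes T': "T' \<in> carrier_mat m n"
    and r: "r \<in> permutations_of_set {0..<m}" and c: "c \<in> permutations_of_set {m..<m + n}"
    and cols: "cols_arranged (T', r, c)" and rows: "rows_arranged (T', r, c)"
  obtains T where "T \<in> carrier_mat m n"
    and "arrange_rows (arrange_cols (EW_labelling T)) = (T', r, c)"
    and "\<And>i j. i < m \<Longrightarrow> j < n \<Longrightarrow> T $$ (r ! i, c ! j - m) = T' $$ (i, j)"
proof -
  have r': "distinct r" "set r = {0..<m}" "length r = m"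
    using r length_finite_permutations_of_set[OF r] by (auto simp: permutations_of_set_def)
  have c': "distinct c" "set c = {m..<m + n}" "length c = n"
    using c length_finite_permutations_of_set[OF c] by (auto simp: permutations_of_set_def)
  \<comment> \<open>\<open>s\<close> and \<open>t\<close> send a position to the index named by its
    label. Column labels start at \<open>m\<close>, hence the subtraction; outside the range both
    are the identity, as \<open>permutes\<close> demands.\<close>
  define s where "s i = (if i < m then r ! i else i)" for i
  define t where "t j = (if j < n then c ! j - m else j)" for j
  have s: "s permutes {..<m}"
  proof (rule bij_imp_permutes)
    have "bij_betw ((!) r) {..<m} {..<m}"
      by (rule bij_betw_nth) (simp_all only: r' atLeast0LessThan)
    then show "bij_betw s {..<m} {..<m}"
      by (rule bij_betw_cong[THEN iffD1, rotated]) (simp add: s_def)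
  qed (simp add: s_def)
  have t: "t permutes {..<n}"
  proof (rule bij_imp_permutes)
    have "bij_betw ((!) c) {..<n} {m..<m + n}"
      by (rule bij_betw_nth) (simp_all only: c')
    moreover have "bij_betw (\<lambda>k. k - m) {m..<m + n} {..<n}"
      by (rule bij_betw_byWitness[where f' = "\<lambda>k. k + m"]) auto
    ultimately have "bij_betw ((\<lambda>k. k - m) \<circ> (!) c) {..<n} {..<n}"
      by (rule bij_betw_trans)
    then show "bij_betw t {..<n} {..<n}"
      by (rule bij_betw_cong[THEN iffD1, rotated]) (simp add: t_def)
  qed (simp add: t_def)
  have dims: "dim_row T' = m" "dim_col T' = n"
    using T' by auto
  \<comment> \<open>\<open>T1\<close> is the stage between the two arrangements: its rows are back
    in label order, its columns are still arranged. In \<open>T\<close> both are in label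
    order.\<close>
  define T1 where "T1 = mat m n (\<lambda>(i, j). T' $$ (inv s i, j))"
  define T where "T = mat m n (\<lambda>(i, j). T1 $$ (i, inv t j))"
  have s_inv: "inv s i < m" if "i < m" for i
    using permutes_in_image[OF permutes_inv[OF s], of i] that by simp
  have t_inv: "inv t j < n" if "j < n" for j
    using permutes_in_image[OF permutes_inv[OF t], of j] that by simp
  have r_inv: "permute_list (inv s) r = [0..<m]"
  proof (rule nth_equalityI)
    fix i assume "i < length (permute_list (inv s) r)"
    then have i: "i < m" using r' by simp
    have "r ! inv s i = s (inv s i)"
      using s_inv[OF i] by (simp add: s_def)
    then show "permute_list (inv s) r ! i = [0..<m] ! i"
      using i r' permutes_inv[OF s] permutes_inverses(1)[OF s]
      by (simp add: permute_list_nth)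
  qed (simp add: r')
  have c_inv: "permute_list (inv t) c = [m..<m + n]"
  proof (rule nth_equalityI)
    fix j assume "j < length (permute_list (inv t) c)"
    then have j: "j < n" using c' by simp
    have "c ! inv t j \<ge> m"
      using nth_mem[of "inv t j" c] t_inv[OF j] c' by auto
    then have "c ! inv t j = m + t (inv t j)"
      using t_inv[OF j] by (simp add: t_def)
    then show "permute_list (inv t) c ! j = [m..<m + n] ! j"
      using j c' permutes_inv[OF t] permutes_inverses(1)[OF t]
      by (simp add: permute_list_nth)
  qed (simp add: c')
  have Y1: "permute_rows (inv s) (T', r, c) = (T1, [0..<m], c)"
    using dims r_inv by (simp add: T1_def)
  have EW: "EW_labelling T = (T, [0..<m], [m..<m + n])"
    by (simp add: EW_labelling_def T_def)
  have X: "permute_cols (inv t) (T1, [0..<m], c) = (T, [0..<m], [m..<m + n])"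
    using c_inv by (simp add: T_def T1_def)
  have fwd: "permute_cols t (T, [0..<m], [m..<m + n]) = (T1, [0..<m], c)"
    using permute_cols_inv_cancel[of t T1 c "[0..<m]"] t c' unfolding X by (simp add: T1_def)
  have bwd: "permute_rows s (T1, [0..<m], c) = (T', r, c)"
    using permute_rows_inv_cancel[of s T' r c] s r' dims unfolding Y1 by simp
  have "cols_arranged (T1, [0..<m], c)"
    using cols_arranged_permute_rows[of "inv s" T' r c] permutes_inv[OF s] dims cols
    unfolding Y1 by simp
  then have "arrange_cols (EW_labelling T) = (T1, [0..<m], c)"
    using arrange_cols_permute_cols[of t T "[m..<m + n]" "[0..<m]"] t
    unfolding EW fwd by (simp only: T_def dim_col_mat length_upt add_diff_cancel_left')
  moreover have "arrange_rows (T1, [0..<m], c) = (T', r, c)"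
    using arrange_rows_permute_rows[of s T1 "[0..<m]" c] s rows
    unfolding bwd by (simp only: T1_def dim_row_mat length_upt diff_zero)
  ultimately have "arrange_rows (arrange_cols (EW_labelling T)) = (T', r, c)"
    by (simp only:)
  moreover have "T $$ (r ! i, c ! j - m) = T' $$ (i, j)" if "i < m" "j < n" for i j
  proof -
    have "s i < m" "t j < n"
      using permutes_in_image[OF s, of i] permutes_in_image[OF t, of j] that by auto
    then have "T $$ (s i, t j) = T' $$ (i, j)"
      using t_inv permutes_inverses(2)[OF s] permutes_inverses(2)[OF t]
      by (simp add: T_def T1_def that)
    then show ?thesis
      using that by (simp add: s_def t_def)
  qed
  moreover have "T \<in> carrier_mat m n"
    by (simp add: T_def)
  ultimately show ?thesis
    using that by blast
qed

section \<open>The shape of a ribbon\<close>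

lemma parallelogram_polyominoesD:
  assumes "P \<in> parallelogram_polyominoes m n"
  shows "P \<in> carrier_mat m n" and "P $$ (0, 0) = 1" and "P $$ (m - 1, n - 1) = 1"
    and "i < m \<Longrightarrow> \<exists>j<n. P $$ (i, j) = 1"
    and "i < m \<Longrightarrow> j < k \<Longrightarrow> k < l \<Longrightarrow> l < n \<Longrightarrow> P $$ (i, j) = 1 \<Longrightarrow> P $$ (i, l) = 1 \<Longrightarrow>
      P $$ (i, k) = 1"
    and "i < m \<Longrightarrow> 1 \<le> i \<Longrightarrow> leftmost P (i - 1) \<le> leftmost P i"
    and "i < m \<Longrightarrow> 1 \<le> i \<Longrightarrow> leftmost P i \<le> rightmost P (i - 1)"
  using assms unfolding parallelogram_polyominoes_def by blast+

text \<open>Contiguity turns the minimum and maximum of a nonempty row into the ends of an interval.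
  The bound \<open>j < n\<close> belongs to the left side so that the equivalence covers every
  \<open>j\<close>.\<close>

lemma parallelogram_row_iff:
  assumes P: "P \<in> parallelogram_polyominoes m n" and i: "i < m"
  shows "j < n \<and> P $$ (i, j) = 1 \<longleftrightarrow> leftmost P i \<le> j \<and> j \<le> rightmost P i"
    and "leftmost P i \<le> rightmost P i" and "rightmost P i < n"
proof -
  let ?S = "{j. j < dim_col P \<and> P $$ (i, j) = 1}"
  have n: "dim_col P = n" and ne: "?S \<noteq> {}"
    using parallelogram_polyominoesD(1,4)[OF P] i by auto
  have fin: "finite ?S" by simp
  have l: "leftmost P i \<in> ?S" and r: "rightmost P i \<in> ?S"
    unfolding leftmost_def rightmost_def by (rule Min_in[OF fin ne] Max_in[OF fin ne])+
  have bounds: "leftmost P i \<le> k \<and> k \<le> rightmost P i" if "k \<in> ?S" for k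
    unfolding leftmost_def rightmost_def using Min_le[OF fin that] Max_ge[OF fin that] by simp
  show "leftmost P i \<le> rightmost P i" "rightmost P i < n"
    using bounds[OF l] r n by auto
  show "j < n \<and> P $$ (i, j) = 1 \<longleftrightarrow> leftmost P i \<le> j \<and> j \<le> rightmost P i"
  proof
    assume j: "leftmost P i \<le> j \<and> j \<le> rightmost P i"
    show "j < n \<and> P $$ (i, j) = 1"
    proof (cases "j = leftmost P i \<or> j = rightmost P i")
      case True
      then show ?thesis using l r n by auto
    next
      case False
      then show ?thesis
        using parallelogram_polyominoesD(5)[OF P i, of "leftmost P i" j "rightmost P i"] j l r n
        by simp
    qed
  qed (use bounds n in auto)
qed

lemma parallelogram_corners:
  assumes P: "P \<in> parallelogram_polyominoes m n" and "m \<ge> 1" "n \<ge> 1"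
  shows "leftmost P 0 = 0" and "rightmost P (m - 1) = n - 1"
proof -
  show "leftmost P 0 = 0"
    using parallelogram_row_iff(1)[OF P, of 0 0] parallelogram_polyominoesD(2)[OF P] assms(2,3)
    by simp
  have "n - 1 \<le> rightmost P (m - 1)"
    using parallelogram_row_iff(1)[OF P, of "m - 1" "n - 1"] parallelogram_polyominoesD(3)[OF P]
      assms(2,3)
    by simp
  then show "rightmost P (m - 1) = n - 1"
    using parallelogram_row_iff(3)[OF P, of "m - 1"] assms(2,3) by simp
qed

lemma parallelogram_step:
  assumes P: "P \<in> parallelogram_polyominoes m n" and "Suc i < m"
  shows "leftmost P i \<le> leftmost P (Suc i)" and "leftmost P (Suc i) \<le> rightmost P i"
  using parallelogram_polyominoesD(6,7)[OF assms] by simp_all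

lemma parallelogram_leftmost_mono:
  assumes P: "P \<in> parallelogram_polyominoes m n" and "i \<le> i'" "i' < m"
  shows "leftmost P i \<le> leftmost P i'"
  using assms(2,3)
proof (induction i' rule: dec_induct)
  case (step k)
  then show ?case using parallelogram_step(1)[OF P, of k] by simp
qed simp

text \<open>Summing row lengths gives m + n - 1. After the first left end 0 and the last right end n
  - 1 are split off, the differences between the right end of a row and the left end of the next sum
  to 0. Each is nonnegative by the overlap condition, so each vanishes.\<close>

lemma ribbon_rightmost:
  assumes R: "R \<in> ribbon_polyominoes m n" and n: "n \<ge> 1" and i: "Suc i < m"
  shows "rightmost R i = leftmost R (Suc i)"
proof -
  have P: "R \<in> parallelogram_polyominoes m n"
    and card: "card {(i, j). i < m \<and> j < n \<and> R $$ (i, j) = 1} = m + n - 1"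
    using R by (auto simp: ribbon_polyominoes_def)
  obtain k where m: "m = Suc k"
    using i by (cases m) auto
  \<comment> \<open>Integers keep the differences free of truncated subtraction.\<close>
  let ?a = "\<lambda>i. int (leftmost R i)" and ?b = "\<lambda>i. int (rightmost R i)"
  have "{j. j < n \<and> R $$ (i, j) = 1} = {leftmost R i..rightmost R i}" if "i < m" for i
    unfolding parallelogram_row_iff(1)[OF P that] by auto
  then have "(SIGMA i:{..<m}. {j. j < n \<and> R $$ (i, j) = 1}) =
      (SIGMA i:{..<m}. {leftmost R i..rightmost R i})"
    by (intro Sigma_cong) auto
  moreover have "{(i, j). i < m \<and> j < n \<and> R $$ (i, j) = 1} =
      (SIGMA i:{..<m}. {j. j < n \<and> R $$ (i, j) = 1})"
    by auto
  ultimately have "int (m + n - 1) = int (\<Sum>i<m. card {leftmost R i..rightmost R i})"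
    using card by simp
  also have "\<dots> = (\<Sum>i<m. ?b i - ?a i + 1)"
    unfolding of_nat_sum
    using parallelogram_row_iff(2)[OF P] by (intro sum.cong) (simp_all add: of_nat_diff le_SucI)
  also have "\<dots> = (\<Sum>i<m. ?b i) - (\<Sum>i<m. ?a i) + int m"
    by (simp add: sum.distrib sum_subtractf)
  also have "(\<Sum>i<m. ?b i) = (\<Sum>i<k. ?b i) + int (n - 1)"
    using parallelogram_corners(2)[OF P _ n] m by simp
  \<comment> \<open>The first row contributes 0, so the index shifts by one and pairs each right end
    with the next left end.\<close>
  also have "(\<Sum>i<m. ?a i) = (\<Sum>i<k. ?a (Suc i))"
    using parallelogram_corners(1)[OF P _ n] m
    by (simp add: sum.lessThan_Suc_shift del: sum.lessThan_Suc)
  finally have "(\<Sum>i<k. ?b i - ?a (Suc i)) = 0"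
    using n m by (simp add: sum_subtractf)
  moreover have "?b i - ?a (Suc i) \<ge> 0" if "i < k" for i
    using parallelogram_step(2)[OF P, of i] m that by simp
  ultimately have "?b i - ?a (Suc i) = 0"
    using i m sum_nonneg_eq_0_iff[of "{..<k}" "\<lambda>i. ?b i - ?a (Suc i)"] by auto
  then show ?thesis by simp
qed

text \<open>In the last row the upper bound is vacuous because the row reaches column n - 1.\<close>

lemma ribbon_iff:
  assumes R: "R \<in> ribbon_polyominoes m n" and ij: "i < m" "j < n"
  shows "R $$ (i, j) = 1 \<longleftrightarrow> leftmost R i \<le> j \<and> (Suc i < m \<longrightarrow> j \<le> leftmost R (Suc i))"
proof -
  have P: "R \<in> parallelogram_polyominoes m n"
    using R by (simp add: ribbon_polyominoes_def)
  show ?thesis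
  proof (cases "Suc i < m")
    case True
    then show ?thesis
      using parallelogram_row_iff(1)[OF P ij(1), of j] ribbon_rightmost[OF R, of i] ij by simp
  next
    case False
    then have "i = m - 1" using ij by simp
    then show ?thesis
      using parallelogram_row_iff(1)[OF P ij(1), of j] parallelogram_corners(2)[OF P] ij False
      by auto
  qed
qed

text \<open>The top cell of column \<open>j\<close> lies in the first row whose right end reaches
  \<open>j\<close>. Written this way, \<open>topmost R j\<close> depends on \<open>j\<close> only
  through its comparisons with the left ends of rows below the first, which are what a column of the
  staircase records.\<close>

lemma ribbon_topmost:
  assumes R: "R \<in> ribbon_polyominoes m n" and m: "m \<ge> 1" and j: "j < n"
  shows "topmost R j = (LEAST i. Suc i < m \<longrightarrow> j \<le> leftmost R (Suc i))"
proof -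
  let ?Q = "\<lambda>i. Suc i < m \<longrightarrow> j \<le> leftmost R (Suc i)"
  let ?t = "LEAST i. ?Q i"
  have P: "R \<in> parallelogram_polyominoes m n" and dim: "dim_row R = m"
    using R parallelogram_polyominoesD(1) by (auto simp: ribbon_polyominoes_def)
  \<comment> \<open>The last row satisfies the condition vacuously, so the least row exists and is
    below \<open>m\<close>.\<close>
  have Q: "?Q (m - 1)" using m by simp
  have t: "?Q ?t" using LeastI[of ?Q, OF Q] .
  have tm: "?t < m" using Least_le[of ?Q, OF Q] m by simp
  have "leftmost R ?t \<le> j"
  proof (cases ?t)
    case 0
    then show ?thesis using parallelogram_corners(1)[OF P m] j by simp
  next
    case (Suc u)
    \<comment> \<open>Failure at the preceding row \<open>u\<close> says exactly that row
      \<open>Suc u\<close> starts strictly left of \<open>j\<close>.\<close>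
    then have "\<not> ?Q u" using not_less_Least[of u ?Q] by simp
    then show ?thesis using Suc by simp
  qed
  then have "R $$ (?t, j) = 1"
    using ribbon_iff[OF R tm j] t by blast
  moreover have "?t \<le> i" if "i < m" "R $$ (i, j) = 1" for i
    using ribbon_iff[OF R that(1) j] that(2) Least_le[of ?Q i] by blast
  ultimately show ?thesis
    unfolding topmost_def dim using tm by (intro Min_eqI) auto
qed

section \<open>The staircase of a ribbon\<close>

text \<open>Row 0 is exempted because \<open>leftmost R 0\<close> is 0, whereas the top row of an
  EW-tableau has no zero. Every other row gets at least the zero in column 0.\<close>

definition staircase :: "tableau \<Rightarrow> tableau" where
  "staircase R = mat (dim_row R) (dim_col R)
     (\<lambda>(i, j). if i \<noteq> 0 \<and> j \<le> leftmost R i then 0 else 1)"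

lemma staircase_nth:
  assumes "R \<in> carrier_mat m n" "i < m" "j < n"
  shows "staircase R $$ (i, j) = (if i \<noteq> 0 \<and> j \<le> leftmost R i then 0 else 1)"
  using assms by (simp add: staircase_def)

lemma ribbon_carrier: "R \<in> ribbon_polyominoes m n \<Longrightarrow> R \<in> carrier_mat m n"
  by (simp add: ribbon_polyominoes_def parallelogram_polyominoesD(1))

text \<open>In a row below the first, a zero is kept only at the left end of the ribbon row, and a
  one only up to the left end of the next row; together they fill the interval. Row 0 consists of
  ones and its interval starts at 0.\<close>

lemma border_ribbon_staircase:
  assumes R: "R \<in> ribbon_polyominoes m n"
  shows "border_ribbon (staircase R) = R"
proof (rule eq_matI)
  have P: "R \<in> parallelogram_polyominoes m n"
    using R by (simp add: ribbon_polyominoes_def)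
  note nth = staircase_nth[OF ribbon_carrier[OF R]]
  have dims: "dim_row R = m" "dim_col R = n"
    using ribbon_carrier[OF R] by auto
  then have dims': "dim_row (staircase R) = m" "dim_col (staircase R) = n"
    by (simp_all add: staircase_def)
  fix i j assume "i < dim_row R" "j < dim_col R"
  then have ij: "i < m" "j < n" using dims by auto
  \<comment> \<open>This covers a zero in the last column, which is always kept: there the left end
    must be n - 1 itself.\<close>
  have a: "leftmost R i < n"
    using parallelogram_row_iff(2,3)[OF P ij(1)] by simp
  have zero: "leftmost R 0 = 0"
    using parallelogram_corners(1)[OF P] ij by simp
  have step: "leftmost R i \<le> leftmost R (Suc i)" if "Suc i < m"
    using parallelogram_step(1)[OF P that] .
  have below: "(i = m - 1 \<or> staircase R $$ (i + 1, j) = 0) \<longleftrightarrow>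
      (Suc i < m \<longrightarrow> j \<le> leftmost R (Suc i))"
  proof (cases "Suc i < m")
    case True
    then show ?thesis
      using ij nth[of "Suc i" j] by (simp split: if_splits)
  next
    case False
    then have "i = m - 1" using ij by linarith
    then show ?thesis using False by simp
  qed
  have right: "(j = n - 1 \<or> staircase R $$ (i, j + 1) = 1) \<longleftrightarrow>
      (Suc j < n \<longrightarrow> i = 0 \<or> leftmost R i < Suc j)"
  proof (cases "Suc j < n")
    case True
    then show ?thesis
      using ij nth[of i "Suc j"] by (auto split: if_splits)
  next
    case False
    then have "j = n - 1" using ij by linarith
    then show ?thesis using False by simp
  qed
  have "border_ribbon (staircase R) $$ (i, j) =
      (if staircase R $$ (i, j) = 1 \<and> (i = m - 1 \<or> staircase R $$ (i + 1, j) = 0) \<or>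
          staircase R $$ (i, j) = 0 \<and> (j = n - 1 \<or> staircase R $$ (i, j + 1) = 1) then 1 else 0)"
    unfolding border_ribbon_def dims' using ij by simp
  then have "border_ribbon (staircase R) $$ (i, j) = 1 \<longleftrightarrow> R $$ (i, j) = 1"
    unfolding below right nth[OF ij] ribbon_iff[OF R ij]
    using a zero step ij by (cases "i = 0") (auto split: if_splits)
  then show "border_ribbon (staircase R) $$ (i, j) = R $$ (i, j)"
    by (metis (full_types) bit_not_one_iff)
qed (simp_all add: border_ribbon_def staircase_def)

text \<open>Zeros form initial segments of rows. Identical staircase columns have equal topmost
  cells in the ribbon, so the column label condition of \<open>LRib\<close> orders them.\<close>

lemma cols_arranged_staircase:
  assumes L: "(R, r, c) \<in> LRib m n" and m: "m \<ge> 1"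
  shows "cols_arranged (staircase R, r, c)"
proof -
  have R: "R \<in> ribbon_polyominoes m n"
    using L by (auto simp: LRib_def)
  have lab: "c ! j < c ! j'" if "j < j'" "j' < n" "topmost R j = topmost R j'" for j j'
    using L that by (auto simp: LRib_def labelled_polyominoes_def)
  note nth = staircase_nth[OF ribbon_carrier[OF R]]
  have dims: "dim_row (staircase R) = m" "dim_col (staircase R) = n"
    using ribbon_carrier[OF R] by (auto simp: staircase_def)
  have top: "topmost R j = topmost R j'"
    if j: "j < n" "j' < n" and eq: "col (staircase R) j = col (staircase R) j'" for j j'
  proof -
    have "j \<le> leftmost R (Suc i) \<longleftrightarrow> j' \<le> leftmost R (Suc i)" if "Suc i < m" for i
    proof -
      have "staircase R $$ (Suc i, j) = staircase R $$ (Suc i, j')"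
        using arg_cong[OF eq, of "\<lambda>v. v $ Suc i"] that dims j by simp
      then show ?thesis
        using nth that j by (simp split: if_splits)
    qed
    then have "(\<lambda>i. Suc i < m \<longrightarrow> j \<le> leftmost R (Suc i)) =
        (\<lambda>i. Suc i < m \<longrightarrow> j' \<le> leftmost R (Suc i))"
      by blast
    then show ?thesis
      using ribbon_topmost[OF R m] j by simp
  qed
  have zero: "staircase R $$ (i, j) = 0"
    if "i < m" "j < j'" "j' < n" "staircase R $$ (i, j') = 0" for i j j'
    using that nth[of i j] nth[of i j'] by (simp split: if_splits)
  show ?thesis
    unfolding cols_arranged.simps dims
  proof (intro conjI allI impI; elim conjE)
    fix j j'
    assume "j < j'" "j' < n" "col (staircase R) j = col (staircase R) j'"
    then show "c ! j < c ! j'"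
      by (intro lab top) simp_all
  qed (rule zero)
qed

text \<open>Left ends increase weakly downwards, so zeros accumulate. Identical rows have equal left
  ends, and the row label condition of \<open>LRib\<close> orders them.\<close>

lemma rows_arranged_staircase:
  assumes L: "(R, r, c) \<in> LRib m n"
  shows "rows_arranged (staircase R, r, c)"
proof -
  have R: "R \<in> ribbon_polyominoes m n" and P: "R \<in> parallelogram_polyominoes m n"
    using L by (auto simp: LRib_def labelled_polyominoes_def)
  have lab: "r ! i < r ! i'" if "i < i'" "i' < m" "leftmost R i = leftmost R i'" for i i'
    using L that by (auto simp: LRib_def labelled_polyominoes_def)
  note nth = staircase_nth[OF ribbon_carrier[OF R]]
  have dims: "dim_row (staircase R) = m" "dim_col (staircase R) = n"
    using ribbon_carrier[OF R] by (auto simp: staircase_def)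
  have left: "leftmost R i = leftmost R i'"
    if i: "i < i'" "i' < m" and eq: "row (staircase R) i = row (staircase R) i'" for i i'
  proof -
    have same: "(i \<noteq> 0 \<and> j \<le> leftmost R i) \<longleftrightarrow> j \<le> leftmost R i'" if "j < n" for j
    proof -
      have "staircase R $$ (i, j) = staircase R $$ (i', j)"
        using arg_cong[OF eq, of "\<lambda>v. v $ j"] that dims i by simp
      then show ?thesis
        using nth that i by (simp split: if_splits)
    qed
    have "leftmost R i < n" "leftmost R i' < n"
      using parallelogram_row_iff(2,3)[OF P] i by (meson le_less_trans less_trans)+
    \<comment> \<open>Taking \<open>j\<close> to be \<open>leftmost R i'\<close> in
      \<open>same\<close> excludes \<open>i = 0\<close> and gives one inequality;
      \<open>leftmost R i\<close> then gives the other.\<close>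
    then show ?thesis
      using same by (meson le_antisym order_refl)
  qed
  have mono: "staircase R $$ (i, j) = 1"
    if "i < i'" "i' < m" "j < n" "staircase R $$ (i', j) = 1" for i i' j
    using that nth parallelogram_leftmost_mono[OF P, of i i'] by (auto split: if_splits)
  show ?thesis
    using left lab mono by (auto simp: dims)
qed

section \<open>The preimage is an EW-tableau\<close>

theorem theorem3p6:
  fixes m n :: nat
  assumes "m \<ge> 1" and "n \<ge> 1"
  shows "\<forall>(R, l) \<in> LRib m n. \<exists>T \<in> EW m n. phi T = (R, l)"
proof -
  have "\<exists>T \<in> EW m n. phi T = (R, r, c)" if L: "(R, r, c) \<in> LRib m n" for R r c
  proof -
    have R: "R \<in> ribbon_polyominoes m n"
      and r: "r \<in> permutations_of_set {0..<m}" and c: "c \<in> permutations_of_set {m..<m + n}"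
      and r0: "r ! 0 = 0"
      using L by (auto simp: LRib_def labelled_polyominoes_def)
    note nth = staircase_nth[OF ribbon_carrier[OF R]]
    have "staircase R \<in> carrier_mat m n"
      using ribbon_carrier[OF R] by (auto simp: staircase_def)
    then obtain T where T: "T \<in> carrier_mat m n"
      and arr: "arrange_rows (arrange_cols (EW_labelling T)) = (staircase R, r, c)"
      and T_nth: "\<And>i j. i < m \<Longrightarrow> j < n \<Longrightarrow> T $$ (r ! i, c ! j - m) = staircase R $$ (i, j)"
      using arranged_preimage r c cols_arranged_staircase[OF L assms(1)]
        rows_arranged_staircase[OF L] by blast
    have row_pos: "\<exists>i<m. x = r ! i" if "x < m" for x
    proof -
      have "x \<in> set r" "length r = m"
        using r that length_finite_permutations_of_set[OF r] by (auto simp: permutations_of_set_def)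
      then show ?thesis by (metis in_set_conv_nth)
    qed
    have col_pos: "\<exists>j<n. y = c ! j - m" if "y < n" for y
    proof -
      have "m + y \<in> set c" "length c = n"
        using c that length_finite_permutations_of_set[OF c] by (auto simp: permutations_of_set_def)
      then show ?thesis by (metis add_diff_cancel_left' in_set_conv_nth)
    qed
    have col_lt: "c ! j - m < n" if "j < n" for j
    proof -
      have "c ! j \<in> {m..<m + n}"
        using c that length_finite_permutations_of_set[OF c] nth_mem[of j c]
        by (auto simp: permutations_of_set_def)
      then show ?thesis by auto
    qed
    \<comment> \<open>Since \<open>r ! 0 = 0\<close>, the top row of \<open>T\<close> is the
      all-ones top row of the staircase, up to the order of columns.\<close>
    have "T $$ (0, y) = 1" if y: "y < n" for y
    proof -
      obtain j where "j < n" "y = c ! j - m" using col_pos[OF y] by blast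
      then show ?thesis using T_nth[of 0 j] nth[of 0 j] r0 assms by simp
    qed
    moreover have "\<exists>y<n. T $$ (x, y) = 0" if x: "x < m" "x \<noteq> 0" for x
    proof -
      obtain i where i: "i < m" "x = r ! i" using row_pos[OF x(1)] by blast
      then have "i \<noteq> 0" using r0 x by metis
      \<comment> \<open>The witness is the column of \<open>T\<close> that becomes column 0 of the
        staircase, where all rows but the first have a zero.\<close>
      then have "T $$ (x, c ! 0 - m) = 0"
        using T_nth[of i 0] nth[of i 0] i assms by simp
      then show ?thesis using col_lt[of 0] assms by auto
    qed
    \<comment> \<open>The forbidden pattern survives reordering of rows and columns, so it would
      occur in the staircase, where it forces both \<open>j < j'\<close> and
      \<open>j' < j\<close>.\<close>
    moreover have False
      if xy: "x < m" "x' < m" "y < n" "y' < n"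
        and T0: "T $$ (x, y) = 0" "T $$ (x', y') = 0"
        and T1: "T $$ (x, y') = 1" "T $$ (x', y) = 1" for x x' y y'
    proof -
      obtain i i' j j' where ij: "i < m" "i' < m" "j < n" "j' < n"
        and eqs: "x = r ! i" "x' = r ! i'" "y = c ! j - m" "y' = c ! j' - m"
        using row_pos col_pos xy by meson
      have "staircase R $$ (i, j) = 0" "staircase R $$ (i', j') = 0"
        "staircase R $$ (i, j') = 1" "staircase R $$ (i', j) = 1"
        using T0 T1 T_nth ij unfolding eqs by auto
      then have "j \<le> leftmost R i" "j' \<le> leftmost R i'"
        "leftmost R i < j'" "leftmost R i' < j"
        using nth ij by (auto split: if_splits)
      then show False by linarith
    qed
    ultimately have "T \<in> EW m n"
      using T unfolding EW_def by blast
    moreover have "phi T = (R, r, c)"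
      using arr border_ribbon_staircase[OF R] by (simp add: phi_def)
    ultimately show ?thesis by blast
  qed
  then show ?thesis by auto
qed

end
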